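(* Let $I\subset\mathbb{R}$ be an interval with interior $I^{\circ}$, and let $f:I\to\mathbb{R}$ be a twice differentiable mapping on $I^{\circ}$ such that $f,f',f''\in L[a,b]$, where $a,b\in I$ with $a<b$. Let $\alpha,\lambda\in[0,1]$. Then $$(b-a)\left(\alpha-\tfrac12\right)f'\big((1-\alpha)b+\alpha a\big)-\frac{1}{b-a}\int_a^b f(x)\,dx+(1-\lambda)f\big((1-\alpha)b+\alpha a\big)+\lambda\big(\alpha f(a)+(1-\alpha)f(b)\big)=\frac{(b-a)^2}{2}\int_0^1 k(t)\,f''\big(tb+(1-t)a\big)\,dt,$$ where $$k(t)=\begin{cases}2\alpha\lambda t-t^2, & 0\le t\le 1-\alpha,\\ (1-t)\big(t-1+2\lambda(1-\alpha)\big), & 1-\alpha\le t\le 1.\end{cases}$$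
   Context: $L[a,b]$ denotes the integrable real-valued functions on $[a,b]$.
   Formalization: f is also assumed continuous on [a,b] (automatic if a,b are interior to I); without it the identity fails, e.g. f(0)=1, f=0 on (0,1], α=1/2, λ=1. At an endpoint of I, f' is the one-sided derivative. *)

theory Defs
  imports "HOL-Analysis.Analysis"
begin

text \<open>
  Derivative of \<open>f\<close> as a function on an interval \<open>I\<close>: the ordinary derivative at interior points
  of \<open>I\<close>, and the one-sided derivative at an endpoint belonging to \<open>I\<close>.  It is meaningful
  only at points where \<open>f\<close> is differentiable within \<open>I\<close>.
\<close>

definition deriv_in :: "real set \<Rightarrow> (real \<Rightarrow> real) \<Rightarrow> real \<Rightarrow> real" where
  "deriv_in I f x = vector_derivative f (at x within I)"

lemma deriv_in_interior:
  assumes "x \<in> interior I" and "f differentiable at x"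
  shows "deriv_in I f x = deriv f x"
proof -
  obtain D where D: "(f has_real_derivative D) (at x)"
    using assms(2) by (auto simp: real_differentiable_def)
  then have "vector_derivative f (at x) = D"
    by (intro vector_derivative_at) (simp only: has_real_derivative_iff_has_vector_derivative)
  then show ?thesis
    using assms(1) DERIV_imp_deriv[OF D] by (simp only: deriv_in_def at_within_interior)
qed

text \<open>
  The two formulas of the kernel generally disagree at \<open>t = 1 - \<alpha>\<close>; the value at this single
  point does not affect the integral, and the first formula is used there.
\<close>

definition ident_kernel :: "real \<Rightarrow> real \<Rightarrow> real \<Rightarrow> real" where
  "ident_kernel \<alpha> lam t =
     (if t \<le> 1 - \<alpha> then 2 * \<alpha> * lam * t - t\<^sup>2
      else (1 - t) * (t - 1 + 2 * lam * (1 - \<alpha>)))"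

end

theory Submission
  imports Defs
begin

text \<open>
  Integrating \<open>k f''\<close> by parts twice on each of the intervals \<open>[0, 1 - \<alpha>]\<close> and \<open>[1 - \<alpha>, 1]\<close>, on which
  \<open>k\<close> is a quadratic polynomial with \<open>k'' = -2\<close>, gives the identity. The integrability of \<open>f''\<close> makes
  \<open>f'\<close> extend continuously from the open interval to \<open>[a, b]\<close>, and the extension is the one-sided
  derivative of \<open>f\<close> at the endpoints; so the boundary terms make sense even for \<open>\<alpha> \<in> {0, 1}\<close>, and no
  absolute continuity has to be assumed.
\<close>

section \<open>The first derivative up to the endpoints\<close>

text \<open>Inside the open interval \<open>f1\<close> differs from the indefinite integral of
  \<open>f2\<close> by a constant, and that integral is continuous on all of \<open>{a..b}\<close>.
  Since \<open>f\<close> is continuous there, it is in turn an indefinite integral of the extension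
  \<open>g\<close>, which gives the one-sided derivatives at the ends.\<close>

lemma derivative_extends_continuously:
  fixes f f1 f2 :: "real \<Rightarrow> real"
  assumes "a < b" and contf: "continuous_on {a..b} f"
    and f1: "\<And>x. x \<in> {a<..<b} \<Longrightarrow> (f has_vector_derivative f1 x) (at x)"
    and f2: "\<And>x. x \<in> {a<..<b} \<Longrightarrow> (f1 has_vector_derivative f2 x) (at x)"
    and int2: "f2 integrable_on {a..b}"
  obtains g where "continuous_on {a..b} g"
    and "\<And>x. x \<in> {a<..<b} \<Longrightarrow> g x = f1 x"
    and "\<And>x. x \<in> {a..b} \<Longrightarrow> (f has_vector_derivative g x) (at x within {a..b})"
proof -
  define F where "F x = integral {a..x} f2" for x
  \<comment> \<open>Any interior point serves to fix the constant of integration; nothing is assumed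
    about \<open>f1\<close> at the ends.\<close>
  define m where "m = (a + b) / 2"
  define g where "g x = F x + (f1 m - F m)" for x
  have m: "m \<in> {a<..<b}"
    using \<open>a < b\<close> by (simp add: m_def)
  have incr: "f1 y - f1 x = F y - F x" if "a < x" "x \<le> y" "y < b" for x y
  proof -
    have "continuous_on {x..y} f1"
      by (intro continuous_at_imp_continuous_on ballI)
        (use that in \<open>auto intro!: has_vector_derivative_continuous f2\<close>)
    then have "(f2 has_integral (f1 y - f1 x)) {x..y}"
      by (rule fundamental_theorem_of_calculus_interior[OF \<open>x \<le> y\<close>]) (use that in \<open>auto intro: f2\<close>)
    moreover have "F x + integral {x..y} f2 = F y"
      unfolding F_def using that
      by (intro Henstock_Kurzweil_Integration.integral_combine integrable_subinterval_real[OF int2]) auto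
    ultimately show ?thesis
      by (simp add: integral_unique)
  qed
  have g_eq: "g x = f1 x" if "x \<in> {a<..<b}" for x
    using incr[of x m] incr[of m x] that m by (cases "x \<le> m") (auto simp: g_def)
  have contg: "continuous_on {a..b} g"
    unfolding g_def F_def by (intro continuous_intros indefinite_integral_continuous_1 int2)
  have f_eq: "f x = f a + integral {a..x} g" if "x \<in> {a..b}" for x
  proof -
    have "(g has_integral (f x - f a)) {a..x}"
      by (rule fundamental_theorem_of_calculus_interior)
        (use that in \<open>auto simp: g_eq intro!: f1 continuous_on_subset[OF contf]\<close>)
    then show ?thesis
      by (simp add: integral_unique)
  qed
  have "(f has_vector_derivative g x) (at x within {a..b})" if "x \<in> {a..b}" for x
  proof (rule has_vector_derivative_transform[OF that])
    show "f y = f a + integral {a..y} g" if "y \<in> {a..b}" for y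
      using that by (rule f_eq)
    show "((\<lambda>y. f a + integral {a..y} g) has_vector_derivative g x) (at x within {a..b})"
      using has_vector_derivative_add[OF has_vector_derivative_const
          integral_has_vector_derivative[OF contg that]] by simp
  qed
  with contg g_eq show thesis
    by (rule that)
qed

text \<open>Bridges derivatives within \<open>{a..b}\<close> and within \<open>I\<close>. At an
  interior point of \<open>I\<close> the full derivative exists and restricts to
  \<open>{a..b}\<close>; any other point of \<open>{a..b}\<close> is an end of both intervals, where
  the two filters coincide.\<close>

lemma deriv_in_eqI:
  fixes f :: "real \<Rightarrow> real"
  assumes I: "is_interval I" "a \<in> I" "b \<in> I" and "a < b" and x: "x \<in> {a..b}"
    and diff: "f differentiable_on interior I"
    and D: "(f has_vector_derivative D) (at x within {a..b})"
  shows "deriv_in I f x = D"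
proof -
  have sub: "{u<..<v} \<subseteq> interior I" if "u \<in> I" "v \<in> I" for u v
    using mem_is_interval_1_I[OF I(1) that] by (intro interior_maximal) auto
  have Icc: "{a..b} \<subseteq> I"
    using mem_is_interval_1_I[OF I] by auto
  have nontriv: "at x within {a..b} \<noteq> bot"
    using x \<open>a < b\<close> by (simp add: trivial_limit_within islimpt_Icc)
  show ?thesis
  proof (cases "x \<in> interior I")
    case True
    then have "f differentiable (at x)"
      using diff differentiable_on_def at_within_open[OF True open_interior] by metis
    then have *: "(f has_vector_derivative vector_derivative f (at x)) (at x)"
      unfolding vector_derivative_works .
    have "vector_derivative f (at x) = D"
      by (rule vector_derivative_unique_within[OF nontriv has_vector_derivative_at_within[OF *] D])
    then show ?thesis
      unfolding deriv_in_def at_within_interior[OF True] .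
  next
    case False
    then have "x \<notin> {a<..<b}"
      using sub[OF I(2,3)] by blast
    with x have "x = a \<or> x = b"
      by auto
    then have "at x within I = at x within {a..b}"
    proof
      assume [simp]: "x = a"
      \<comment> \<open>A point of \<open>I\<close> to the left of \<open>a\<close> would put
        \<open>a\<close> in the interior of \<open>I\<close>.\<close>
      have "y \<ge> a" if "y \<in> I" for y
        using subsetD[OF sub[OF that I(3)], of x] False \<open>a < b\<close> by (intro leI) auto
      then have "I \<inter> {..<b} - {a} = {a..b} \<inter> {..<b} - {a}"
        using Icc by auto
      then show ?thesis
        using \<open>a < b\<close> by (intro at_within_nhd[where S = "{..<b}"]) auto
    next
      assume [simp]: "x = b"
      have "y \<le> b" if "y \<in> I" for y
        using subsetD[OF sub[OF I(2) that], of x] False \<open>a < b\<close> by (intro leI) auto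
      then have "I \<inter> {a<..} - {b} = {a..b} \<inter> {a<..} - {b}"
        using Icc by auto
      then show ?thesis
        using \<open>a < b\<close> by (intro at_within_nhd[where S = "{a<..}"]) auto
    qed
    with vector_derivative_within[OF nontriv D] show ?thesis
      unfolding deriv_in_def by metis
  qed
qed

section \<open>Integration by parts, affine substitution, integrability\<close>

text \<open>The terms \<open>p1 * h1\<close> cancel when \<open>p * h1 - p1 * h\<close> is
  differentiated. Continuity up to the ends suffices there, so the lemma reaches \<open>a\<close>
  and \<open>b\<close>.\<close>

lemma has_integral_by_parts_twice:
  fixes h h1 h2 p p1 p2 :: "real \<Rightarrow> real"
  assumes "u \<le> v"
    and "continuous_on {u..v} h" "continuous_on {u..v} h1"
    and "continuous_on {u..v} p" "continuous_on {u..v} p1"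
    and h: "\<And>t. t \<in> {u<..<v} \<Longrightarrow> (h has_real_derivative h1 t) (at t)"
      "\<And>t. t \<in> {u<..<v} \<Longrightarrow> (h1 has_real_derivative h2 t) (at t)"
    and p: "\<And>t. t \<in> {u<..<v} \<Longrightarrow> (p has_real_derivative p1 t) (at t)"
      "\<And>t. t \<in> {u<..<v} \<Longrightarrow> (p1 has_real_derivative p2 t) (at t)"
  shows "((\<lambda>t. p t * h2 t - p2 t * h t) has_integral
           (p v * h1 v - p1 v * h v) - (p u * h1 u - p1 u * h u)) {u..v}"
proof (rule fundamental_theorem_of_calculus_interior[OF \<open>u \<le> v\<close>])
  show "continuous_on {u..v} (\<lambda>t. p t * h1 t - p1 t * h t)"
    using assms(2-5) by (intro continuous_intros)
  fix t assume t: "t \<in> {u<..<v}"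
  show "((\<lambda>t. p t * h1 t - p1 t * h t) has_vector_derivative p t * h2 t - p2 t * h t) (at t)"
    unfolding has_real_derivative_iff_has_vector_derivative[symmetric]
    by (auto intro!: derivative_eq_intros h[OF t] p[OF t] simp: algebra_simps)
qed

lemma has_integral_affine_unit:
  fixes f :: "real \<Rightarrow> real"
  assumes "a < b" and "(f has_integral J) {a..b}"
  shows "((\<lambda>t. f (t * b + (1 - t) * a)) has_integral J / (b - a)) {0..1}"
proof -
  have "(b - a) * t + a = t * b + (1 - t) * a" for t
    by (simp add: algebra_simps)
  then show ?thesis
    using has_integral_affinity'[of f J a b "b - a" a] assms by (simp add: divide_inverse_commute)
qed

lemma absolutely_integrable_affine_unit:
  fixes f :: "real \<Rightarrow> real"
  assumes "a < b" and "f absolutely_integrable_on {a..b}"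
  shows "(\<lambda>t. f (t * b + (1 - t) * a)) absolutely_integrable_on {0..1}"
  using assms has_integral_affine_unit[OF \<open>a < b\<close>, of f]
    has_integral_affine_unit[OF \<open>a < b\<close>, of "\<lambda>x. norm (f x)"]
  unfolding absolutely_integrable_on_def integrable_on_def by blast

text \<open>A bounded measurable factor preserves absolute integrability. As the kernel may jump,
  its bound comes from the two polynomials, each continuous on all of \<open>{0..1}\<close>.\<close>

lemma ident_kernel_absolutely_integrable:
  assumes "g absolutely_integrable_on {0..1}"
  shows "(\<lambda>t. ident_kernel \<alpha> lam t * g t) absolutely_integrable_on {0..1}"
proof (rule absolutely_integrable_bounded_measurable_product_real)
  have "ident_kernel \<alpha> lam \<in> borel_measurable borel"
    unfolding ident_kernel_def by measurable
  then show "ident_kernel \<alpha> lam \<in> borel_measurable (lebesgue_on {0..1})"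
    by (intro measurable_restrict_space1 measurable_completion) simp
  have "bounded ((\<lambda>t. 2 * \<alpha> * lam * t - t\<^sup>2) ` {0..1}
      \<union> (\<lambda>t. (1 - t) * (t - 1 + 2 * lam * (1 - \<alpha>))) ` {0..1})"
    unfolding bounded_Un
    by (intro conjI compact_imp_bounded compact_continuous_image continuous_intros) auto
  then show "bounded (ident_kernel \<alpha> lam ` {0..1})"
    by (rule bounded_subset) (auto simp: ident_kernel_def)
qed (use assms in auto)

section \<open>The identity, assembled from the two pieces of the kernel\<close>

text \<open>Continuity of \<open>f\<close> on \<open>{a..b}\<close> ties \<open>f a\<close> and
  \<open>f b\<close> to the values inside: at an end of \<open>I\<close>, differentiability on the
  interior says nothing about \<open>f\<close>.\<close>

theorem lemma2:
  fixes I :: "real set" and f :: "real \<Rightarrow> real" and a b \<alpha> lam :: real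
  defines "f' \<equiv> deriv_in I f"
  defines "f'' \<equiv> deriv_in I f'"
  defines "c \<equiv> (1 - \<alpha>) * b + \<alpha> * a"
  assumes "is_interval I"
    and "a \<in> I" and "b \<in> I" and "a < b"
    and "f differentiable_on interior I"
    and "f' differentiable_on interior I"
    and "continuous_on {a..b} f"
    and "f absolutely_integrable_on {a..b}"
    and "f' absolutely_integrable_on {a..b}"
    and "f'' absolutely_integrable_on {a..b}"
    and "\<alpha> \<in> {0..1}" and "lam \<in> {0..1}"
  shows "(b - a) * (\<alpha> - 1 / 2) * f' c
           - 1 / (b - a) * (LINT x:{a..b}|lebesgue. f x)
           + (1 - lam) * f c
           + lam * (\<alpha> * f a + (1 - \<alpha>) * f b)
         = (b - a)\<^sup>2 / 2 *
           (LINT t:{0..1}|lebesgue. ident_kernel \<alpha> lam t * f'' (t * b + (1 - t) * a))"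
proof -
  define L where "L = b - a"
  define \<phi> where "\<phi> t = t * b + (1 - t) * a" for t
  have I: "is_interval I" "a \<in> I" "b \<in> I" and ab: "a < b"
    and diff: "f differentiable_on interior I" "f' differentiable_on interior I"
    and contf: "continuous_on {a..b} f"
    and int: "f absolutely_integrable_on {a..b}" "f'' absolutely_integrable_on {a..b}"
    and \<alpha>: "0 \<le> \<alpha>" "\<alpha> \<le> 1"
    using assms by auto
  have "L > 0"
    using ab by (simp add: L_def)
  have int_HK: "f integrable_on {a..b}" "f'' integrable_on {a..b}"
    using int by (simp_all add: absolutely_integrable_on_def)
  have interior: "{a<..<b} \<subseteq> interior I"
    using mem_is_interval_1_I[OF I] by (intro interior_maximal) auto
  have deriv: "(h has_vector_derivative deriv_in I h x) (at x)"
    if "h differentiable_on interior I" "x \<in> {a<..<b}" for h x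
  proof -
    have x: "x \<in> interior I"
      using interior that by blast
    then have "h differentiable (at x)"
      using that(1) differentiable_on_def at_within_open[OF x open_interior] by metis
    then show ?thesis
      unfolding vector_derivative_works deriv_in_def at_within_interior[OF x] .
  qed
  have d1: "(f has_vector_derivative f' x) (at x)" if "x \<in> {a<..<b}" for x
    unfolding f'_def by (rule deriv[OF diff(1) that])
  have d2: "(f' has_vector_derivative f'' x) (at x)" if "x \<in> {a<..<b}" for x
    unfolding f''_def by (rule deriv[OF diff(2) that])
  obtain g where g: "continuous_on {a..b} g"
    and gd: "\<And>x. x \<in> {a..b} \<Longrightarrow> (f has_vector_derivative g x) (at x within {a..b})"
    by (rule derivative_extends_continuously[OF ab contf d1 d2 int_HK(2)]) auto
  \<comment> \<open>Including the ends, so that \<open>f' c\<close> is the right boundary term even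
    when \<open>c\<close> is \<open>a\<close> or \<open>b\<close>.\<close>
  have "g x = f' x" if "x \<in> {a..b}" for x
    unfolding f'_def by (rule deriv_in_eqI[symmetric, OF I ab that diff(1) gd[OF that]])
  then have contf': "continuous_on {a..b} f'"
    using g continuous_on_cong[OF refl, of "{a..b}" g f'] by blast
  have \<phi>_eq: "\<phi> t = a + t * L" for t
    by (simp add: \<phi>_def L_def algebra_simps)
  have b_eq: "b = a + 1 * L"
    by (simp add: L_def)
  have \<phi>: "\<phi> t \<in> {a..b}" if "t \<in> {0..1}" for t
    using that \<open>L > 0\<close> mult_right_mono[of t 1 L] unfolding \<phi>_eq b_eq by simp
  have \<phi>': "\<phi> t \<in> {a<..<b}" if "t \<in> {0<..<1}" for t
    using that \<open>L > 0\<close> mult_strict_right_mono[of t 1 L] unfolding \<phi>_eq b_eq by simp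
  have d\<phi>: "(\<phi> has_real_derivative L) (at t)" for t
    unfolding \<phi>_eq[abs_def] by (auto intro!: derivative_eq_intros)
  have cont\<phi>: "continuous_on {u..v} (\<lambda>t. h (\<phi> t))"
    if "continuous_on {a..b} h" "{u..v} \<subseteq> {0..1}" for h :: "real \<Rightarrow> real" and u v
    by (rule continuous_on_compose2[OF that(1)])
      (use \<phi> that(2) in \<open>auto simp: \<phi>_eq intro!: continuous_intros\<close>)
  \<comment> \<open>Each differentiation of \<open>f\<close> along \<open>\<phi>\<close> contributes
    a factor \<open>L\<close>; the summand \<open>2 * f (\<phi> t)\<close> comes from the second
    derivative \<open>- 2\<close> of \<open>p\<close>.\<close>
  have piece: "((\<lambda>t. p t * (f'' (\<phi> t) * L * L) + 2 * f (\<phi> t)) has_integral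
      (p v * (f' (\<phi> v) * L) - p1 v * f (\<phi> v)) - (p u * (f' (\<phi> u) * L) - p1 u * f (\<phi> u))) {u..v}"
    if uv: "0 \<le> u" "u \<le> v" "v \<le> 1"
      and p: "\<And>t. (p has_real_derivative p1 t) (at t)" "\<And>t. (p1 has_real_derivative - 2) (at t)"
    for u v p p1
  proof -
    have "((\<lambda>t. f (\<phi> t)) has_real_derivative f' (\<phi> t) * L) (at t)"
      "((\<lambda>t. f' (\<phi> t) * L) has_real_derivative f'' (\<phi> t) * L * L) (at t)"
      if "t \<in> {u<..<v}" for t
      using that uv d1[OF \<phi>'] d2[OF \<phi>']
      unfolding has_real_derivative_iff_has_vector_derivative[symmetric]
      by (auto intro!: DERIV_cmult_right DERIV_chain2[OF _ d\<phi>])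
    moreover have "continuous_on {u..v} p" "continuous_on {u..v} p1"
      using p by (meson DERIV_isCont continuous_at_imp_continuous_on)+
    moreover have "continuous_on {u..v} (\<lambda>t. f (\<phi> t))" "continuous_on {u..v} (\<lambda>t. f' (\<phi> t) * L)"
      using uv by (intro continuous_intros cont\<phi> contf contf'; simp)+
    ultimately show ?thesis
      using has_integral_by_parts_twice[of u v "\<lambda>t. f (\<phi> t)" "\<lambda>t. f' (\<phi> t) * L" p p1
          "\<lambda>t. f'' (\<phi> t) * L * L" "\<lambda>_. - 2"] uv p
      by simp
  qed
  let ?k = "ident_kernel \<alpha> lam"
  let ?s = "1 - \<alpha>"
  let ?H = "\<lambda>t. ?k t * (f'' (\<phi> t) * L * L) + 2 * f (\<phi> t)"
  have \<phi>_vals: "\<phi> 0 = a" "\<phi> 1 = b" "\<phi> ?s = c"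
    by (simp_all add: \<phi>_def c_def)
  have "((\<lambda>t. 2 * \<alpha> * lam * t - t\<^sup>2) has_real_derivative 2 * \<alpha> * lam - 2 * t) (at t)"
    "((\<lambda>t. 2 * \<alpha> * lam - 2 * t) has_real_derivative - 2) (at t)" for t
    by (auto intro!: derivative_eq_intros)
  \<comment> \<open>The polynomial vanishes at \<open>0\<close>, so \<open>f' a\<close> drops
    out.\<close>
  from piece[of 0 ?s, OF _ _ _ this] \<alpha>
  have "((\<lambda>t. (2 * \<alpha> * lam * t - t\<^sup>2) * (f'' (\<phi> t) * L * L) + 2 * f (\<phi> t)) has_integral
      ((2 * \<alpha> * lam * ?s - ?s\<^sup>2) * (f' c * L) - (2 * \<alpha> * lam - 2 * ?s) * f c)
        + 2 * \<alpha> * lam * f a) {0..?s}"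
    by (simp add: \<phi>_vals)
  then have left: "(?H has_integral
      ((2 * \<alpha> * lam * ?s - ?s\<^sup>2) * (f' c * L) - (2 * \<alpha> * lam - 2 * ?s) * f c)
        + 2 * \<alpha> * lam * f a) {0..?s}"
    by (rule has_integral_spike_finite[of "{}", rotated 2]) (auto simp: ident_kernel_def)
  have "((\<lambda>t. (1 - t) * (t - 1 + 2 * lam * (1 - \<alpha>))) has_real_derivative
      2 - 2 * t - 2 * lam * (1 - \<alpha>)) (at t)"
    "((\<lambda>t. 2 - 2 * t - 2 * lam * (1 - \<alpha>)) has_real_derivative - 2) (at t)" for t
    by (auto intro!: derivative_eq_intros)
  \<comment> \<open>The polynomial vanishes at \<open>1\<close>, so \<open>f' b\<close> drops
    out.\<close>
  from piece[of ?s 1, OF _ _ _ this] \<alpha>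
  have "((\<lambda>t. (1 - t) * (t - 1 + 2 * lam * (1 - \<alpha>)) * (f'' (\<phi> t) * L * L) + 2 * f (\<phi> t)) has_integral
      2 * lam * (1 - \<alpha>) * f b - (\<alpha> * (2 * lam * (1 - \<alpha>) - \<alpha>) * (f' c * L)
        - (2 * \<alpha> - 2 * lam * (1 - \<alpha>)) * f c)) {?s..1}"
    by (simp add: \<phi>_vals algebra_simps)
  then have right: "(?H has_integral
      2 * lam * (1 - \<alpha>) * f b - (\<alpha> * (2 * lam * (1 - \<alpha>) - \<alpha>) * (f' c * L)
        - (2 * \<alpha> - 2 * lam * (1 - \<alpha>)) * f c)) {?s..1}"
    \<comment> \<open>At \<open>?s\<close> the kernel takes its first formula, so this one point is
      exceptional.\<close>
    by (rule has_integral_spike_finite[of "{?s}", rotated 2]) (auto simp: ident_kernel_def)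
  define J where "J = (LINT x:{a..b}|lebesgue. f x)"
  define K where "K = (LINT t:{0..1}|lebesgue. ?k t * f'' (t * b + (1 - t) * a))"
  have "(f has_integral J) {a..b}"
    using has_integral_set_lebesgue[OF int(1)] by (simp add: J_def)
  then have "((\<lambda>t. f (\<phi> t)) has_integral J / L) {0..1}"
    unfolding \<phi>_def L_def by (rule has_integral_affine_unit[OF ab])
  moreover have "((\<lambda>t. ?k t * f'' (\<phi> t)) has_integral K) {0..1}"
    unfolding K_def \<phi>_def
    by (rule has_integral_set_lebesgue ident_kernel_absolutely_integrable
        absolutely_integrable_affine_unit ab int(2))+
  ultimately have "((\<lambda>t. L\<^sup>2 * (?k t * f'' (\<phi> t)) + 2 * f (\<phi> t)) has_integral
      L\<^sup>2 * K + 2 * (J / L)) {0..1}"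
    by (intro has_integral_add has_integral_mult_right)
  then have "(?H has_integral L\<^sup>2 * K + 2 * (J / L)) {0..1}"
    by (simp add: power2_eq_square ac_simps)
  \<comment> \<open>The integral of \<open>?H\<close> over \<open>{0..1}\<close> is computed in two
    ways: by linearity and from the boundary terms.\<close>
  from has_integral_unique[OF this has_integral_combine[OF _ _ left right]] \<alpha>
  have "L\<^sup>2 * K + 2 * (J / L) =
      ((2 * \<alpha> * lam * ?s - ?s\<^sup>2) * (f' c * L) - (2 * \<alpha> * lam - 2 * ?s) * f c) + 2 * \<alpha> * lam * f a
      + (2 * lam * (1 - \<alpha>) * f b - (\<alpha> * (2 * lam * (1 - \<alpha>) - \<alpha>) * (f' c * L)
        - (2 * \<alpha> - 2 * lam * (1 - \<alpha>)) * f c))"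
    by simp
  \<comment> \<open>At \<open>c\<close> the coefficient of \<open>f' c * L\<close> collapses to
    \<open>\<alpha>\<^sup>2 - (1 - \<alpha>)\<^sup>2 = 2 * \<alpha> - 1\<close> and that of
    \<open>f c\<close> to \<open>2 * (1 - lam)\<close>; halving gives the claim.\<close>
  then have "L * (\<alpha> - 1 / 2) * f' c - J / L + (1 - lam) * f c
      + lam * (\<alpha> * f a + (1 - \<alpha>) * f b) = L\<^sup>2 / 2 * K"
    by (simp add: power2_eq_square algebra_simps)
  then show ?thesis
    by (simp add: L_def J_def K_def)
qed

end
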